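(* Let $T$ be a tree with $n$ vertices and let $d\ge 1$ be an integer. Then for every positive integer $k$, $$\pi_T^{(Q_d)}(k) = \frac{1}{2^d}\sum_{S\subseteq V(T),\ |S|=d} k(k-1)^{n+d-1-\deg(S)}(k-2)^{\deg(S)-\operatorname{int}(S)}(k-3)^{\operatorname{int}(S)},$$ where $\deg(S)=\sum_{v\in S}\deg(v)$ and $\operatorname{int}(S)$ is the number of edges of $T$ with both endpoints in $S$.
   Context: $Q_d = K_2\,\square\,K_2\,\square\cdots\square\,K_2$ ($d$ factors) is the $d$-dimensional hypercube graph, where $\square$ is the Cartesian product of graphs. For a positive integer $k$, a proper $k$-coloring of a graph $G$ is a map $V(G)\to\{1,\dots,k\}$ giving adjacent vertices different colors. The $k$-coloring graph $\mathcal{C}_k(G)$ has the proper $k$-colorings of $G$ as vertices, two colorings adjacent iff they differ in the color of exactly one vertex. For a graph $H$, $\pi_G^{(H)}(k)$ is the number of vertex subsets $U$ of $\mathcal{C}_k(G)$ whose induced subgraph is isomorphic to $H$. *)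

theory Defs
  imports
    Complex_Main
    "HOL-Library.FuncSet"
    "Graph_Theory.Pair_Digraph"
    "Graph_Theory.Digraph_Component"
    "Graph_Theory.Digraph_Isomorphism"
begin

text \<open>
  A finite simple graph is a \<^locale>\<open>pair_graph\<close>: every undirected edge is represented by its
  two arcs.
\<close>

(* The library predicate "tree" forbids all directed cycles, which include the closed walk u, v, u
   along a single edge, so it fails for every symmetric graph with an edge. In a symmetric loopless
   graph without parallel arcs the cycles of length at least 3 are exactly the undirected cycles. *)
definition is_tree :: "'a pair_pre_digraph \<Rightarrow> bool" where
  "is_tree T \<longleftrightarrow> pair_graph T \<and> Digraph_Component.connected (with_proj T) \<and>
     \<not> (\<exists>p. pre_digraph.cycle (with_proj T) p \<and> length p \<ge> 3)"

definition cartesian_product ::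
    "'a pair_pre_digraph \<Rightarrow> 'b pair_pre_digraph \<Rightarrow> ('a \<times> 'b) pair_pre_digraph" where
  "cartesian_product G H =
     \<lparr> pverts = pverts G \<times> pverts H,
       parcs = {((u, x), (v, y)). (u = v \<and> u \<in> pverts G \<and> (x, y) \<in> parcs H) \<or>
                                  ((u, v) \<in> parcs G \<and> x = y \<and> x \<in> pverts H)} \<rparr>"

definition relabel :: "('a \<Rightarrow> 'b) \<Rightarrow> 'a pair_pre_digraph \<Rightarrow> 'b pair_pre_digraph" where
  "relabel f G = \<lparr> pverts = f ` pverts G, parcs = map_prod f f ` parcs G \<rparr>"

definition K2 :: "bool pair_pre_digraph" where
  "K2 = \<lparr> pverts = {False, True}, parcs = {(False, True), (True, False)} \<rparr>"

(* The nested pairs of the iterated product are flattened to lists of length d, so that all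
   hypercubes have the same vertex type; the empty product is the one-vertex graph. *)
primrec hypercube :: "nat \<Rightarrow> bool list pair_pre_digraph" where
  "hypercube 0 = \<lparr> pverts = {[]}, parcs = {} \<rparr>"
| "hypercube (Suc d) = relabel (\<lambda>(b, bs). b # bs) (cartesian_product K2 (hypercube d))"

(* Colorings are extensional functions (undefined outside the vertex set), so that each map
   V(G) \<rightarrow> {1,...,k} is represented exactly once. *)
definition proper_colorings :: "'a pair_pre_digraph \<Rightarrow> nat \<Rightarrow> ('a \<Rightarrow> nat) set" where
  "proper_colorings G k =
     {f \<in> pverts G \<rightarrow>\<^sub>E {1..k}. \<forall>u v. (u, v) \<in> parcs G \<longrightarrow> f u \<noteq> f v}"

definition coloring_graph :: "'a pair_pre_digraph \<Rightarrow> nat \<Rightarrow> ('a \<Rightarrow> nat) pair_pre_digraph" where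
  "coloring_graph G k =
     \<lparr> pverts = proper_colorings G k,
       parcs = {(f, g). f \<in> proper_colorings G k \<and> g \<in> proper_colorings G k \<and>
                        (\<exists>!v. v \<in> pverts G \<and> f v \<noteq> g v)} \<rparr>"

definition induced_count :: "'a pair_pre_digraph \<Rightarrow> 'b pair_pre_digraph \<Rightarrow> nat \<Rightarrow> nat" where
  "induced_count G H k =
     card {U. U \<subseteq> pverts (coloring_graph G k) \<and>
              digraph_iso (with_proj (coloring_graph G k) \<restriction> U) (with_proj H)}"

(* By symmetry the out-degree of a vertex is its degree in the undirected graph. *)
definition deg_set :: "'a pair_pre_digraph \<Rightarrow> 'a set \<Rightarrow> nat" where
  "deg_set G S = (\<Sum>v\<in>S. out_degree (with_proj G) v)"

(* Undirected edges, i.e. two-element sets of vertices, are counted, not arcs. *)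
definition int_set :: "'a pair_pre_digraph \<Rightarrow> 'a set \<Rightarrow> nat" where
  "int_set G S = card {{u, v} | u v. (u, v) \<in> parcs G \<and> u \<in> S \<and> v \<in> S}"

end

theory Submission
  imports Defs
begin

text \<open>
  An induced $Q_d$ in the coloring graph is a box: there are $d$ vertices $S$ of the tree that
  switch independently between two colors, while all others keep one color. So hypercubes
  correspond to assignments of color sets, of size 2 on $S$ and of size 1 elsewhere, that are
  disjoint along every edge. For a tree these are counted by adding one leaf $v$ with neighbour
  $u$ at a time: given the set at $u$, of size $s_u$, there are $\binom{k-s_u}{s_v}$ choices at $v$.
  The binomials with $s_v = 2$ account for the factor $2^{-d}$.
\<close>

section \<open>Hypercubes in Hamming graphs\<close>

text \<open>The exponents come from counting linear factors. A vertex in S contributes two and any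
  other vertex one, so there are n + d in all, and one of them, from the root, is k itself. An edge
  from u to a later vertex v contributes k - 1 if neither end is in S, k - 2 if only u is, (k - 1)(k
  - 2)/2 if only v is, and (k - 2)(k - 3)/2 if both are. So k - 2 occurs once per edge meeting S,
  which is deg(S) - int(S) times, and k - 3 once per edge inside S. The other n + d - 1 - deg(S)
  factors are k - 1, whichever root is chosen. That an induced cube is a box is a fact about Hamming
  graphs. Properness enters afterwards and makes the color sets at the two ends of an edge
  disjoint.\<close>

lemma digraph_iso_induce_iff:
  assumes "pair_wf_digraph G" "pair_wf_digraph H" "U \<subseteq> pverts G"
  shows "digraph_iso (with_proj G \<restriction> U) (with_proj H) \<longleftrightarrow>
    (\<exists>h. bij_betw h U (pverts H) \<and>
      (\<forall>x\<in>U. \<forall>y\<in>U. (x, y) \<in> parcs G \<longleftrightarrow> (h x, h y) \<in> parcs H))"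
    (is "?L \<longleftrightarrow> ?R")
proof
  interpret G: wf_digraph "with_proj G" using assms(1) by (simp add: wf_digraph_wp_iff)
  let ?I = "with_proj G \<restriction> U"
  {
    assume ?L
    then obtain f where f: "pre_digraph.digraph_isomorphism ?I f" and H: "with_proj H = app_iso f ?I"
      unfolding digraph_iso_def by blast
    note f' = f[unfolded pre_digraph.digraph_isomorphism_def]
    have v: "pverts H = iso_verts f ` U" and a: "parcs H = iso_arcs f ` arcs ?I"
      and t: "iso_tail f = fst" and h: "iso_head f = snd"
      using arg_cong[OF H, of verts] arg_cong[OF H, of arcs]
        arg_cong[OF H, of tail] arg_cong[OF H, of head] by simp_all
    \<comment> \<open>Tails and heads are \<open>fst\<close> and \<open>snd\<close> on both sides,
      so the vertex map forces the arc map.\<close>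
    have e: "iso_arcs f (x, y) = (iso_verts f x, iso_verts f y)"
      if "(x, y) \<in> parcs G" "x \<in> U" "y \<in> U" for x y
      using f' that t h by (auto simp: prod_eq_iff)
    have inj: "inj_on (iso_verts f) U" using f' by simp
    have "bij_betw (iso_verts f) U (pverts H)" using inj v by (simp add: bij_betw_def)
    moreover have "(x, y) \<in> parcs G \<longleftrightarrow> (iso_verts f x, iso_verts f y) \<in> parcs H"
      if "x \<in> U" "y \<in> U" for x y
    proof
      assume "(x, y) \<in> parcs G"
      then show "(iso_verts f x, iso_verts f y) \<in> parcs H"
        unfolding a using e[of x y] that by (force intro: rev_image_eqI)
    next
      assume "(iso_verts f x, iso_verts f y) \<in> parcs H"
      then obtain z w where "(z, w) \<in> parcs G" "z \<in> U" "w \<in> U"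
        "iso_arcs f (z, w) = (iso_verts f x, iso_verts f y)"
        unfolding a by auto
      with e[of z w] inj that show "(x, y) \<in> parcs G" by (auto dest: inj_onD)
    qed
    ultimately show ?R by blast
  }
  {
    assume ?R
    then obtain h where bij: "bij_betw h U (pverts H)"
      and arc: "\<And>x y. x \<in> U \<Longrightarrow> y \<in> U \<Longrightarrow> (x, y) \<in> parcs G \<longleftrightarrow> (h x, h y) \<in> parcs H"
      by blast
    have inj: "inj_on h U" and img: "h ` U = pverts H" using bij by (auto simp: bij_betw_def)
    define f where "f = \<lparr>iso_verts = h, iso_arcs = map_prod h h, iso_head = snd, iso_tail = fst\<rparr>"
    have "pre_digraph.digraph_isomorphism ?I f"
      unfolding pre_digraph.digraph_isomorphism_def
      using inj G.wellformed_induce_subgraph[of U]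
      by (auto simp: f_def inj_on_def)
    moreover have "map_prod h h ` arcs ?I = parcs H"
    proof (intro equalityI subsetI)
      fix e assume "e \<in> parcs H"
      \<comment> \<open>Well-formedness of \<open>H\<close> puts both ends of the arc into
        \<open>pverts H\<close>, the image of \<open>h\<close>.\<close>
      then obtain x y where "e = (h x, h y)" "x \<in> U" "y \<in> U"
        using assms(2) img unfolding pair_wf_digraph_def by (metis imageE prod.collapse)
      then show "e \<in> map_prod h h ` arcs ?I"
        using arc[of x y] \<open>e \<in> parcs H\<close> by (force intro: rev_image_eqI)
    qed (use arc in auto)
    then have "with_proj H = app_iso f ?I"
      using img by (auto simp: app_iso_def f_def with_proj_def)
    ultimately show ?L unfolding digraph_iso_def by blast
  }
qed

lemma wf_coloring_graph: "pair_wf_digraph (coloring_graph G k)"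
  by unfold_locales (auto simp: coloring_graph_def)

section \<open>The cube graph as the subsets of a finite set\<close>

lemma pverts_hypercube: "pverts (hypercube d) = {bs. length bs = d}"
  by (induction d)
    (auto simp: relabel_def cartesian_product_def K2_def image_iff length_Suc_conv)

lemma hypercube_Suc_arc:
  "(b # bs, c # cs) \<in> parcs (hypercube (Suc d)) \<longleftrightarrow>
    (b = c \<and> (bs, cs) \<in> parcs (hypercube d)) \<or> (b \<noteq> c \<and> bs = cs \<and> length bs = d)"
proof -
  have inj: "map_prod (\<lambda>(b, bs). b # bs) (\<lambda>(b, bs). b # bs) e = (b # bs, c # cs) \<longleftrightarrow>
      e = ((b, bs), (c, cs))" for e
    by (cases e) auto
  have "(b # bs, c # cs) \<in> parcs (hypercube (Suc d)) \<longleftrightarrow>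
      ((b, bs), (c, cs)) \<in> parcs (cartesian_product K2 (hypercube d))"
    by (simp add: relabel_def image_iff) (metis inj)
  then show ?thesis by (cases b; cases c) (auto simp: cartesian_product_def K2_def pverts_hypercube)
qed

lemma wf_hypercube: "pair_wf_digraph (hypercube d)"
proof (induction d)
  case 0
  show ?case by unfold_locales auto
next
  case (Suc d)
  then interpret pair_wf_digraph "hypercube d" .
  show ?case
    by unfold_locales
      (auto simp: relabel_def cartesian_product_def K2_def map_prod_def image_iff pverts_hypercube
        dest: in_arcsD1 in_arcsD2)
qed

declare hypercube.simps(2) [simp del]

text \<open>Subsets suit the rigidity argument, which removes elements one at a time. The index set
  is left open because it is used both as \<open>{..<d}\<close> and as the set of vertices that
  switch color.\<close>

lemma hypercube_Pow:
  assumes "finite D"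
  shows "\<exists>h. bij_betw h (pverts (hypercube (card D))) (Pow D) \<and>
    (\<forall>x\<in>pverts (hypercube (card D)). \<forall>y\<in>pverts (hypercube (card D)).
      (x, y) \<in> parcs (hypercube (card D)) \<longleftrightarrow> (\<exists>!i. (i \<in> h x) \<noteq> (i \<in> h y)))"
  using assms
proof (induction D)
  case empty
  show ?case by (rule exI[of _ "\<lambda>_. {}"]) (auto simp: bij_betw_def)
next
  case (insert a D)
  let ?Q = "hypercube (card D)"
  obtain h where h: "bij_betw h (pverts ?Q) (Pow D)"
    and arc: "\<forall>x\<in>pverts ?Q. \<forall>y\<in>pverts ?Q.
      (x, y) \<in> parcs ?Q \<longleftrightarrow> (\<exists>!i. (i \<in> h x) \<noteq> (i \<in> h y))"
    using insert.IH by (elim exE conjE)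
  define h' where "h' bs = (if hd bs then insert a (h (tl bs)) else h (tl bs))" for bs
  have sub: "h bs \<subseteq> D" if "length bs = card D" for bs
    using h that by (auto simp: bij_betw_def pverts_hypercube)
  have inj: "h bs = h cs \<longleftrightarrow> bs = cs" if "length bs = card D" "length cs = card D" for bs cs
    using h that by (auto simp: bij_betw_def pverts_hypercube inj_on_def)
  have h'a: "a \<in> h' (b # bs) \<longleftrightarrow> b" and h'i: "i \<noteq> a \<Longrightarrow> i \<in> h' (b # bs) \<longleftrightarrow> i \<in> h bs"
    if "length bs = card D" for b bs i
    using sub[OF that] insert.hyps by (auto simp: h'_def)
  have card: "card (insert a D) = Suc (card D)" using insert.hyps by simp
  show ?case
    unfolding card
  proof (intro exI[of _ h'] conjI ballI)
    show "bij_betw h' (pverts (hypercube (Suc (card D)))) (Pow (insert a D))"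
      unfolding bij_betw_def
    proof
      show "inj_on h' (pverts (hypercube (Suc (card D))))"
      proof (rule inj_onI)
        fix x y assume xy: "x \<in> pverts (hypercube (Suc (card D)))"
          "y \<in> pverts (hypercube (Suc (card D)))" "h' x = h' y"
        then obtain b bs c cs where [simp]: "x = b # bs" "y = c # cs"
          and l: "length bs = card D" "length cs = card D"
          by (auto simp: pverts_hypercube length_Suc_conv)
        have "b = c" using h'a[OF l(1), of b] h'a[OF l(2), of c] xy(3) by simp
        moreover have "h bs = h cs"
        proof (rule set_eqI)
          fix i show "i \<in> h bs \<longleftrightarrow> i \<in> h cs"
            using h'i[OF l(1), of i b] h'i[OF l(2), of i c] xy(3) sub[OF l(1)] sub[OF l(2)]
              insert.hyps by (cases "i = a") auto
        qed
        ultimately show "x = y" using inj[OF l] by simp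
      qed
      show "h' ` pverts (hypercube (Suc (card D))) = Pow (insert a D)"
      proof (intro equalityI subsetI)
        fix J assume "J \<in> Pow (insert a D)"
        then have "J - {a} \<in> h ` pverts ?Q" using h by (auto simp: bij_betw_def)
        then obtain bs where "length bs = card D" "h bs = J - {a}"
          by (auto simp: pverts_hypercube)
        then show "J \<in> h' ` pverts (hypercube (Suc (card D)))"
          by (intro image_eqI[of _ _ "(a \<in> J) # bs"])
            (auto simp: h'_def pverts_hypercube)
      next
        fix J assume "J \<in> h' ` pverts (hypercube (Suc (card D)))"
        then obtain b bs where "J = h' (b # bs)" "length bs = card D"
          by (auto simp: pverts_hypercube length_Suc_conv)
        then show "J \<in> Pow (insert a D)" using sub[of bs] by (auto simp: h'_def)
      qed
    qed
  next
    fix x y assume "x \<in> pverts (hypercube (Suc (card D)))" "y \<in> pverts (hypercube (Suc (card D)))"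
    then obtain b bs c cs where [simp]: "x = b # bs" "y = c # cs"
      and l: "length bs = card D" "length cs = card D"
      by (auto simp: pverts_hypercube length_Suc_conv)
    let ?d = "\<lambda>i. (i \<in> h' x) \<noteq> (i \<in> h' y)" and ?e = "\<lambda>i. (i \<in> h bs) \<noteq> (i \<in> h cs)"
    have da: "?d a \<longleftrightarrow> b \<noteq> c" using h'a[OF l(1), of b] h'a[OF l(2), of c] by simp
    have ea: "\<not> ?e a" using sub[OF l(1)] sub[OF l(2)] insert.hyps by auto
    have de: "?d i \<longleftrightarrow> ?e i" if "i \<noteq> a" for i
      using h'i[OF l(1) that] h'i[OF l(2) that] by simp
    \<comment> \<open>The unique difference is either \<open>a\<close>, and then nothing else
      differs, or it lies elsewhere and \<open>a\<close> agrees. These are the two kinds of arcs in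
      the Cartesian product.\<close>
    have ex1: "(\<exists>!i. P i) \<longleftrightarrow> (\<not> P a \<and> (\<exists>!i. R i)) \<or> (P a \<and> (\<forall>i. \<not> R i))"
      if "\<not> R a" "\<And>i. i \<noteq> a \<Longrightarrow> P i = R i" for P R :: "'a \<Rightarrow> bool"
      using that by metis
    have "(\<exists>!i. ?d i) \<longleftrightarrow> (\<not> ?d a \<and> (\<exists>!i. ?e i)) \<or> (?d a \<and> (\<forall>i. \<not> ?e i))"
      by (rule ex1) (fact ea, fact de)
    then have "(\<exists>!i. ?d i) \<longleftrightarrow> (b = c \<and> (\<exists>!i. ?e i)) \<or> (b \<noteq> c \<and> (\<forall>i. \<not> ?e i))"
      by (simp only: da not_not)
    moreover have "(\<forall>i. \<not> ?e i) \<longleftrightarrow> bs = cs" using inj[OF l] by (simp add: set_eq_iff)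
    ultimately show "(x, y) \<in> parcs (hypercube (Suc (card D))) \<longleftrightarrow> (\<exists>!i. ?d i)"
      using arc[rule_format, of bs cs] l by (simp add: hypercube_Suc_arc pverts_hypercube)
  qed
qed

text \<open>
  The edges at the empty set move pairwise different coordinates, since their other ends are not
  adjacent. The rest of the cube is then forced: in the Hamming graph, two points that differ in
  exactly two coordinates have only two common neighbours.
\<close>

lemma cube_rigid:
  fixes \<Phi> :: "'i set \<Rightarrow> 'a \<Rightarrow> 'c"
  assumes fin: "finite D" and inj: "inj_on \<Phi> (Pow D)"
    and adj: "\<And>I J. I \<subseteq> D \<Longrightarrow> J \<subseteq> D \<Longrightarrow>
      (\<exists>!i. (i \<in> I) \<noteq> (i \<in> J)) \<longleftrightarrow> (\<exists>!v. \<Phi> I v \<noteq> \<Phi> J v)"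
  obtains x c where "inj_on x D" "\<And>v. v \<in> x ` D \<Longrightarrow> c v \<noteq> \<Phi> {} v"
    "\<And>J. J \<subseteq> D \<Longrightarrow> \<Phi> J = (\<lambda>v. if v \<in> x ` J then c v else \<Phi> {} v)"
proof -
  have "\<exists>v. \<Phi> {i} v \<noteq> \<Phi> {} v \<and> (\<forall>w. w \<noteq> v \<longrightarrow> \<Phi> {i} w = \<Phi> {} w)" if "i \<in> D" for i
    using adj[of "{i}" "{}"] that by auto
  then obtain x where x: "\<And>i. i \<in> D \<Longrightarrow> \<Phi> {i} (x i) \<noteq> \<Phi> {} (x i)"
    "\<And>i w. i \<in> D \<Longrightarrow> w \<noteq> x i \<Longrightarrow> \<Phi> {i} w = \<Phi> {} w"
    by metis
  have xinj: "inj_on x D"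
  proof (rule inj_onI, rule ccontr)
    \<comment> \<open>If two edges at the empty set moved the same coordinate, their ends would
      differ only there and be adjacent, but \<open>{i}\<close> and \<open>{j}\<close> differ in two
      elements.\<close>
    fix i j assume ij: "i \<in> D" "j \<in> D" "x i = x j" "i \<noteq> j"
    have "\<Phi> {i} \<noteq> \<Phi> {j}" using inj_onD[OF inj, of "{i}" "{j}"] ij by auto
    moreover have "\<Phi> {i} w = \<Phi> {j} w" if "w \<noteq> x i" for w using x(2) ij that by metis
    ultimately have "\<exists>!v. \<Phi> {i} v \<noteq> \<Phi> {j} v" by (metis ext)
    then have "\<exists>!l. (l \<in> {i}) \<noteq> (l \<in> {j})" using adj[of "{i}" "{j}"] ij by simp
    then show False using \<open>i \<noteq> j\<close> by (metis singletonD singletonI)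
  qed
  \<comment> \<open>The second value at \<open>v\<close> is read off the singleton whose edge moves
    \<open>v\<close>.\<close>
  define c where "c v = \<Phi> {the_inv_into D x v} v" for v
  have cx: "c (x i) = \<Phi> {i} (x i)" if "i \<in> D" for i
    using that xinj by (simp add: c_def the_inv_into_f_f)
  define \<Psi> where "\<Psi> J = (\<lambda>v. if v \<in> x ` J then c v else \<Phi> {} v)" for J
  have "\<Phi> J = \<Psi> J" if "J \<subseteq> D" for J
    using finite_subset[OF that fin] that
  proof (induction J rule: finite_psubset_induct)
    case (psubset J)
    consider "J = {}" | i where "J = {i}" | i j where "i \<in> J" "j \<in> J" "i \<noteq> j" by blast
    then show ?case
    proof cases
      case 1
      then show ?thesis by (simp add: \<Psi>_def)
    next
      case (2 i)
      then show ?thesis using x cx psubset.prems by (auto simp: \<Psi>_def fun_eq_iff)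
    next
      case (3 i j)
      have sub: "J - {j} \<subseteq> D" "J - {i} \<subseteq> D" using psubset.prems by auto
      have iD: "i \<in> D" "j \<in> D" using 3 psubset.prems by auto
      have xij: "x i \<noteq> x j" using xinj iD 3 by (auto dest: inj_onD)
      have P: "\<Phi> (J - {j}) = \<Psi> (J - {j})" and Q: "\<Phi> (J - {i}) = \<Psi> (J - {i})"
        and R: "\<Phi> (J - {i, j}) = \<Psi> (J - {i, j})"
        by (rule psubset.IH; use 3 psubset.prems in blast)+
      have mem: "x l \<in> x ` K \<longleftrightarrow> l \<in> K" if "K \<subseteq> D" "l \<in> D" for K l
        using that xinj by (auto dest: inj_onD)
      have PQ: "\<Psi> (J - {j}) (x i) \<noteq> \<Psi> (J - {i}) (x i)" "\<Psi> (J - {j}) (x j) \<noteq> \<Psi> (J - {i}) (x j)"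
        using 3 iD psubset.prems x(1)[OF iD(1)] x(1)[OF iD(2)] by (auto simp: \<Psi>_def cx mem[OF _ iD(1)] mem[OF _ iD(2)] subset_iff)
      have "\<exists>!l. (l \<in> J) \<noteq> (l \<in> J - {j})" "\<exists>!l. (l \<in> J) \<noteq> (l \<in> J - {i})" using 3 by auto
      then have "\<exists>!v. \<Phi> J v \<noteq> \<Psi> (J - {j}) v" "\<exists>!v. \<Phi> J v \<noteq> \<Psi> (J - {i}) v"
        by (simp_all only: adj[OF psubset.prems sub(1)] adj[OF psubset.prems sub(2)] P Q)
      then obtain y z where y: "\<And>v. \<Phi> J v = \<Psi> (J - {j}) v \<longleftrightarrow> v \<noteq> y"
        and z: "\<And>v. \<Phi> J v = \<Psi> (J - {i}) v \<longleftrightarrow> v \<noteq> z"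
        by metis
      \<comment> \<open>At \<open>x i\<close> the two neighbours disagree, so \<Phi> J differs there
        from at least one of them; likewise at \<open>x j\<close>. Each neighbour differs from
        \<Phi> J in one place only, so \<open>y\<close> and \<open>z\<close> are these two
        coordinates in some order.\<close>
      have yz: "(y = x i \<and> z = x j) \<or> (y = x j \<and> z = x i)"
        using y[of "x i"] y[of "x j"] z[of "x i"] z[of "x j"] PQ xij by metis
      have img: "v \<in> x ` J \<longleftrightarrow> v \<in> x ` (J - {l})" if "v \<noteq> x l" for v l
        using that by auto
      have img2: "v \<in> x ` (J - {j}) \<longleftrightarrow> v \<in> x ` (J - {i, j})" if "v \<noteq> x i" for v
        using that by auto
      (* y = x i would mean that coordinate x i is changed back, so that \<Phi> J = \<Phi> (J - {i, j}). *)
      have "y \<noteq> x i"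
      proof
        assume "y = x i"
        then have zj: "z = x j" using yz xij by auto
        have "\<Phi> J v = \<Psi> (J - {i, j}) v" for v
        proof (cases "v = x i")
          case True
          have "\<Phi> J v = \<Psi> (J - {i}) v" using z[of v] zj True xij by simp
          also have "\<dots> = \<Psi> (J - {i, j}) v"
            using True iD psubset.prems by (simp add: \<Psi>_def mem subset_iff Diff_eq)
          finally show ?thesis .
        next
          case False
          then have "\<Phi> J v = \<Psi> (J - {j}) v" using y[of v] \<open>y = x i\<close> by simp
          also have "\<dots> = \<Psi> (J - {i, j}) v" using img2[OF False] by (simp add: \<Psi>_def)
          finally show ?thesis .
        qed
        then have "\<Phi> J = \<Phi> (J - {i, j})" using R by auto
        then show False using inj_onD[OF inj, of J "J - {i, j}"] psubset.prems 3 by auto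
      qed
      then have yj: "y = x j" and zi: "z = x i" using yz by auto
      show ?thesis
      proof
        fix v show "\<Phi> J v = \<Psi> J v"
        proof (cases "v = x j")
          case True
          then have "\<Phi> J v = \<Psi> (J - {i}) v" using z[of v] zi xij by simp
          then show ?thesis using img[of v i] True xij by (simp add: \<Psi>_def)
        next
          case False
          then have "\<Phi> J v = \<Psi> (J - {j}) v" using y[of v] yj by simp
          then show ?thesis using img[OF False] by (simp add: \<Psi>_def)
        qed
      qed
    qed
  qed
  then have eq: "\<Phi> J = (\<lambda>v. if v \<in> x ` J then c v else \<Phi> {} v)" if "J \<subseteq> D" for J
    using that by (simp add: \<Psi>_def)
  have "c v \<noteq> \<Phi> {} v" if "v \<in> x ` D" for v using that cx x(1) by force
  from that[OF xinj this eq] show ?thesis .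
qed

section \<open>Growing a tree\<close>

text \<open>This is all that the counting needs from a tree: each new vertex has exactly one earlier
  neighbour. Connectedness and the absence of cycles serve only to produce such an order.\<close>

inductive grown :: "('a \<times> 'a) set \<Rightarrow> 'a set \<Rightarrow> bool" for E where
  root: "grown E {r}"
| leaf: "grown E X \<Longrightarrow> u \<in> X \<Longrightarrow> v \<notin> X \<Longrightarrow> (u, v) \<in> E \<Longrightarrow>
    (\<And>w. w \<in> X \<Longrightarrow> (w, v) \<in> E \<Longrightarrow> w = u) \<Longrightarrow> grown E (insert v X)"

lemma grown_finite: "grown E X \<Longrightarrow> finite X"
  by (induction rule: grown.induct) auto

text \<open>Needed to close a cycle: the path must stay in \<open>X\<close> so that a vertex outside
  \<open>X\<close> can be joined to both of its ends without repetition.\<close>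

lemma (in pair_graph) grown_apath:
  assumes "grown (parcs G) X" "X \<subseteq> pverts G" "a \<in> X" "b \<in> X"
  shows "\<exists>p. apath a p b \<and> set (pawalk_verts a p) \<subseteq> X"
  using assms
proof (induction arbitrary: a b rule: grown.induct)
  case (root r)
  then show ?case by (intro exI[of _ "[]"]) (auto simp: apath_Nil_iff)
next
  case (leaf X u v)
  have X: "X \<subseteq> pverts G" using leaf.prems by auto
  have vu: "(v, u) \<in> parcs G" using arcs_symmetric[OF leaf.hyps(4)] .
  have from_v: "\<exists>p. apath v p b \<and> set (pawalk_verts v p) \<subseteq> insert v X" if "b \<in> X" for b
  proof -
    obtain p where p: "apath u p b" "set (pawalk_verts u p) \<subseteq> X"
      using leaf.IH[OF X \<open>u \<in> X\<close> \<open>b \<in> X\<close>] by auto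
    have "apath v ((v, u) # p) b"
      using p leaf.hyps(3) vu leaf.prems(1) by (auto simp: apath_Cons_iff)
    moreover have "set (pawalk_verts v ((v, u) # p)) \<subseteq> insert v X" using p by auto
    ultimately show ?thesis by blast
  qed
  consider "a = v" "b = v" | "a = v" "b \<in> X" | "a \<in> X" "b = v" | "a \<in> X" "b \<in> X"
    using leaf.prems by blast
  then show ?case
  proof cases
    case 1
    then show ?thesis using leaf.prems by (intro exI[of _ "[]"]) (auto simp: apath_Nil_iff)
  next
    case 2
    then show ?thesis using from_v by simp
  next
    case 3
    \<comment> \<open>Prepending an arc only gives paths that start at the new leaf; those that end
      there are obtained by reversal.\<close>
    then obtain p where p: "apath v p a" "set (pawalk_verts v p) \<subseteq> insert v X"
      using from_v by blast
    then have "pawalk_verts a (rev_path p) = rev (pawalk_verts v p)"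
      using awalk_verts_rev_path by (auto simp: apath_def)
    then show ?thesis using p 3 by (intro exI[of _ "rev_path p"]) auto
  next
    case 4
    then show ?thesis using leaf.IH[OF X] by blast
  qed
qed

text \<open>Take a maximal grown set. If it misses a vertex, connectedness gives an arc leaving it,
  and a second neighbour of the arc's head inside the set would close a cycle; so the set could be
  enlarged.\<close>

lemma is_tree_grown:
  assumes "is_tree T"
  shows "grown (parcs T) (pverts T)"
proof -
  interpret pair_graph T using assms by (simp add: is_tree_def)
  have nocyc: "\<not> (cycle p \<and> length p \<ge> 3)" for p using assms by (auto simp: is_tree_def)
  have conn: "Digraph_Component.connected (with_proj T)" using assms by (simp add: is_tree_def)
  then have sc: "strongly_connected (with_proj T)"
    by (intro symmetric_connected_imp_strongly_connected pair_sym_arcs)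
  define M where "M = {X. X \<subseteq> pverts T \<and> grown (parcs T) X}"
  obtain r where r: "r \<in> pverts T" using sc by (auto simp: strongly_connected_def)
  then have "{r} \<in> M" by (simp add: M_def grown.root)
  moreover have "finite M"
    unfolding M_def by (rule finite_subset[of _ "Pow (pverts T)"]) auto
  ultimately obtain X where XM: "X \<in> M" and max: "\<And>Y. Y \<in> M \<Longrightarrow> X \<subseteq> Y \<Longrightarrow> X = Y" and "{r} \<subseteq> X"
    using finite_has_maximal2[of M "{r}"] by blast
  then have X: "X \<subseteq> pverts T" "grown (parcs T) X" "r \<in> X" by (auto simp: M_def)
  have "X = pverts T"
  proof (rule ccontr)
    assume "X \<noteq> pverts T"
    then obtain y where y: "y \<in> pverts T" "y \<notin> X" using X by auto
    have "r \<rightarrow>\<^sup>*\<^bsub>with_proj T\<^esub> y" using sc r y by (auto simp: strongly_connected_def)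
    \<comment> \<open>Induction along the walk from \<open>r\<close>: either it is still in
      \<open>X\<close>, or some arc leaving \<open>X\<close> has been met.\<close>
    then have "y \<in> X \<or> (\<exists>u v. u \<in> X \<and> v \<notin> X \<and> (u, v) \<in> parcs T)"
      by (induction rule: reachable_induct) (use X in auto)
    then obtain u v where uv: "u \<in> X" "v \<notin> X" "(u, v) \<in> parcs T" using y by blast
    have v: "v \<in> pverts T" using uv in_arcsD2 by blast
    have "w = u" if w: "w \<in> X" "(w, v) \<in> parcs T" for w
    proof (rule ccontr)
      assume "w \<noteq> u"
      obtain p where p: "apath u p w" "set (pawalk_verts u p) \<subseteq> X"
        using grown_apath[of X u w] X uv w by auto
      have "p \<noteq> []" using p \<open>w \<noteq> u\<close> by (auto simp: apath_Nil_iff)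
      \<comment> \<open>The path \<open>p\<close> is nonempty because its ends differ, so the closed
        walk through \<open>v\<close> has length at least 3 and is not a walk back and forth along
        one edge.\<close>
      let ?c = "(v, u) # p @ [(w, v)]"
      have pw: "awalk u p w" and pd: "distinct (pawalk_verts u p)" using p by (auto simp: apath_def)
      have "awalk v ?c v"
        using pw uv w arcs_symmetric[OF uv(3)] v by (auto simp: awalk_simps)
      moreover have "pawalk_verts v ?c = v # pawalk_verts u p @ [v]"
        using pw by (auto simp: awalk_verts_conv)
      ultimately have "cycle ?c"
        unfolding cycle_def using pd p uv by (intro exI[of _ v]) auto
      moreover have "length ?c \<ge> 3" using \<open>p \<noteq> []\<close> by (cases p) auto
      ultimately show False using nocyc by blast
    qed
    then have "grown (parcs T) (insert v X)" using X(2) uv by (intro grown.leaf)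
    then have "insert v X \<in> M" using X(1) v by (simp add: M_def)
    then show False using max[of "insert v X"] uv(2) by auto
  qed
  then show ?thesis using X by simp
qed

section \<open>Counting boxes\<close>

text \<open>A box is the product of the sets \<open>A v\<close>; disjointness along arcs makes every
  point of it a proper coloring. Arcs and vertices are separate arguments so that \<open>X\<close>
  can grow while \<open>E\<close> stays fixed.\<close>

definition boxes :: "('a \<times> 'a) set \<Rightarrow> 'a set \<Rightarrow> nat \<Rightarrow> ('a \<Rightarrow> nat) \<Rightarrow> ('a \<Rightarrow> nat set) set" where
  "boxes E X k s = {A \<in> X \<rightarrow>\<^sub>E Pow {1..k}. (\<forall>v\<in>X. card (A v) = s v) \<and>
     (\<forall>u\<in>X. \<forall>v\<in>X. (u, v) \<in> E \<longrightarrow> A u \<inter> A v = {})}"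

lemma finite_boxes: "finite X \<Longrightarrow> finite (boxes E X k s)"
  unfolding boxes_def by (rule finite_subset[of _ "X \<rightarrow>\<^sub>E Pow {1..k}"]) (auto intro: finite_PiE)

lemma card_boxes_singleton:
  assumes "(r, r) \<notin> E"
  shows "card (boxes E {r} k s) = k choose s r"
proof -
  have "bij_betw (\<lambda>A. A r) (boxes E {r} k s) {B. B \<subseteq> {1..k} \<and> card B = s r}"
    by (rule bij_betw_byWitness[where f' = "\<lambda>B. \<lambda>v\<in>{r}. B"])
      (use assms in \<open>auto simp: boxes_def PiE_iff extensional_def fun_eq_iff\<close>)
  then show ?thesis using n_subsets[of "{1..k}" "s r"] by (simp add: bij_betw_same_card)
qed

text \<open>Split a box into its restriction to \<open>X\<close> and its set at \<open>v\<close>.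
  The latter only has to avoid \<open>A u\<close>, so all fibres of the restriction have the same
  size.\<close>

lemma card_boxes_insert:
  assumes "finite X" "sym E" "irrefl E" "u \<in> X" "v \<notin> X" "(u, v) \<in> E"
    and uniq: "\<And>w. w \<in> X \<Longrightarrow> (w, v) \<in> E \<Longrightarrow> w = u"
  shows "card (boxes E (insert v X) k s) = card (boxes E X k s) * ((k - s u) choose s v)"
proof -
  let ?B = "\<lambda>A. {B. B \<subseteq> {1..k} - A u \<and> card B = s v}"
  have E: "(v, u) \<in> E" "\<And>w. w \<in> X \<Longrightarrow> (v, w) \<in> E \<Longrightarrow> w = u" "(v, v) \<notin> E"
    using symD[OF assms(2)] irreflD[OF assms(3)] assms(6) uniq by blast+
  have "bij_betw (\<lambda>A. (restrict A X, A v)) (boxes E (insert v X) k s) (Sigma (boxes E X k s) ?B)"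
  proof (rule bij_betw_byWitness[where f' = "\<lambda>(A, B). A(v := B)"])
    show "\<forall>A\<in>boxes E (insert v X) k s. (\<lambda>(A, B). A(v := B)) (restrict A X, A v) = A"
      using assms(5) by (auto simp: boxes_def PiE_iff extensional_def fun_eq_iff)
    show "\<forall>AB\<in>Sigma (boxes E X k s) ?B.
        (\<lambda>A. (restrict A X, A v)) ((\<lambda>(A, B). A(v := B)) AB) = AB"
      using assms(5) by (auto simp: boxes_def PiE_iff extensional_def fun_eq_iff)
    show "(\<lambda>A. (restrict A X, A v)) ` boxes E (insert v X) k s \<subseteq> Sigma (boxes E X k s) ?B"
    proof
      fix P assume "P \<in> (\<lambda>A. (restrict A X, A v)) ` boxes E (insert v X) k s"
      then obtain A where A: "A \<in> boxes E (insert v X) k s" and P: "P = (restrict A X, A v)"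
        by blast
      have "restrict A X \<in> boxes E X k s"
        using A by (simp add: boxes_def PiE_iff)
      moreover have "A u \<inter> A v = {}" "A v \<subseteq> {1..k}" "card (A v) = s v"
        using A assms(4,6) unfolding boxes_def PiE_iff by blast+
      ultimately show "P \<in> Sigma (boxes E X k s) ?B"
        using \<open>u \<in> X\<close> unfolding P by auto
    qed
    show "(\<lambda>(A, B). A(v := B)) ` Sigma (boxes E X k s) ?B \<subseteq> boxes E (insert v X) k s"
    proof
      fix A' assume "A' \<in> (\<lambda>(A, B). A(v := B)) ` Sigma (boxes E X k s) ?B"
      then obtain A B where A: "A \<in> boxes E X k s" and B: "B \<subseteq> {1..k} - A u" "card B = s v"
        and A': "A' = A(v := B)" by auto
      have "A' \<in> insert v X \<rightarrow>\<^sub>E Pow {1..k}"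
        using A B unfolding A' by (auto simp: boxes_def PiE_iff extensional_def)
      moreover have "\<forall>x\<in>insert v X. card (A' x) = s x"
        using A B assms(5) unfolding A' by (auto simp: boxes_def)
      moreover have "A' x \<inter> A' y = {}" if "x \<in> insert v X" "y \<in> insert v X" "(x, y) \<in> E" for x y
      proof -
        have disj: "A p \<inter> A q = {}" if "p \<in> X" "q \<in> X" "(p, q) \<in> E" for p q
          using A that unfolding boxes_def by blast
        consider "x = v" "y = u" | "x = u" "y = v" | "x \<in> X" "y \<in> X"
          using \<open>x \<in> insert v X\<close> \<open>y \<in> insert v X\<close> \<open>(x, y) \<in> E\<close> E(2,3) uniq by blast
        then show ?thesis
          by cases (use disj[of x y] \<open>(x, y) \<in> E\<close> B assms(4,5) in \<open>auto simp: A'\<close>)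
      qed
      ultimately show "A' \<in> boxes E (insert v X) k s" unfolding boxes_def by blast
    qed
  qed
  then have "card (boxes E (insert v X) k s) = card (Sigma (boxes E X k s) ?B)"
    by (rule bij_betw_same_card)
  also have "\<dots> = (\<Sum>A\<in>boxes E X k s. card (?B A))"
    by (rule card_SigmaI) (use assms(1) in \<open>auto simp: finite_boxes\<close>)
  also have "\<dots> = (\<Sum>A\<in>boxes E X k s. (k - s u) choose s v)"
  proof (rule sum.cong)
    fix A assume "A \<in> boxes E X k s"
    then have "A u \<subseteq> {1..k}" "card (A u) = s u" using \<open>u \<in> X\<close> by (auto simp: boxes_def PiE_iff)
    then have "card ({1..k} - A u) = k - s u"
      by (simp add: card_Diff_subset finite_subset)
    then show "card (?B A) = (k - s u) choose s v" using n_subsets[of "{1..k} - A u" "s v"] by simp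
  qed simp
  finally show ?thesis by simp
qed

text \<open>The subtraction on the right is real, so m = 0 needs no exception.\<close>

lemma real_choose_2: "real (m choose 2) = real m * (real m - 1) / 2"
  by (induction m) (auto simp: numeral_2_eq_2 field_simps)

section \<open>The exponents of k - 1, k - 2 and k - 3\<close>

definition box_size :: "'a set \<Rightarrow> 'a \<Rightarrow> nat" where
  "box_size S v = (if v \<in> S then 2 else 1)"

text \<open>
  Versions of \<^const>\<open>deg_set\<close> and \<^const>\<open>int_set\<close> for the subgraph induced by \<open>X\<close>, which
  can be tracked while the tree grows.
\<close>

definition incident_arcs :: "('a \<times> 'a) set \<Rightarrow> 'a set \<Rightarrow> 'a set \<Rightarrow> ('a \<times> 'a) set" where
  "incident_arcs E S X = {(u, v) \<in> E. u \<in> S \<inter> X \<and> v \<in> X}"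

definition inner_edges :: "('a \<times> 'a) set \<Rightarrow> 'a set \<Rightarrow> 'a set \<Rightarrow> 'a set set" where
  "inner_edges E S X = {{u, v} | u v. (u, v) \<in> E \<and> u \<in> S \<inter> X \<and> v \<in> S \<inter> X}"

lemma finite_incident_arcs: "finite X \<Longrightarrow> finite (incident_arcs E S X)"
  unfolding incident_arcs_def by (rule finite_subset[of _ "X \<times> X"]) auto

lemma finite_inner_edges: "finite X \<Longrightarrow> finite (inner_edges E S X)"
  unfolding inner_edges_def by (rule finite_subset[of _ "Pow X"]) auto

text \<open>The exponents are natural numbers fixed by equations without subtraction. This keeps the
  induction free of truncation and later shows that the exponents in the theorem are nonnegative.
  Edges inside \<open>S\<close> give two incident arcs, so \<open>b\<close> counts the edges that
  meet \<open>S\<close>.\<close>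

lemma card_boxes_grown:
  assumes "grown E X" "sym E" "irrefl E"
  shows "\<exists>a b. a + card (incident_arcs E S X) + 1 = card X + card (X \<inter> S) \<and>
     b + card (inner_edges E S X) = card (incident_arcs E S X) \<and>
     2 ^ card (X \<inter> S) * real (card (boxes E X k (box_size S))) =
       real k * (real k - 1) ^ a * (real k - 2) ^ b * (real k - 3) ^ card (inner_edges E S X)"
  using assms
proof (induction rule: grown.induct)
  case (root r)
  have rr: "(r, r) \<notin> E" using root by (auto dest: irreflD)
  then have "incident_arcs E S {r} = {}" "inner_edges E S {r} = {}"
    by (auto simp: incident_arcs_def inner_edges_def)
  moreover have "2 ^ card ({r} \<inter> S) * real (card (boxes E {r} k (box_size S))) =
      real k * (real k - 1) ^ (if r \<in> S then 1 else 0)"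
    using card_boxes_singleton[OF rr, of k "box_size S"] by (simp add: box_size_def real_choose_2)
  ultimately show ?case
    \<comment> \<open>The root gives k, or k (k - 1) / 2 if it lies in \<open>S\<close>.\<close>
    by (intro exI[of _ "if r \<in> S then 1 else 0"] exI[of _ 0]) auto
next
  case (leaf X u v)
  let ?X = "insert v X" and ?n = "\<lambda>X. card (boxes E X k (box_size S))"
  let ?D = "\<lambda>X. card (incident_arcs E S X)" and ?I = "\<lambda>X. card (inner_edges E S X)"
  let ?u = "of_bool (u \<in> S) :: nat" and ?v = "of_bool (v \<in> S) :: nat"
  obtain a b where ab: "a + ?D X + 1 = card X + card (X \<inter> S)" "b + ?I X = ?D X"
    and n: "2 ^ card (X \<inter> S) * real (?n X) =
      real k * (real k - 1) ^ a * (real k - 2) ^ b * (real k - 3) ^ ?I X"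
    using leaf.IH leaf.prems by blast
  have fin: "finite X" using leaf.hyps(1) by (rule grown_finite)
  have E: "(v, u) \<in> E" "\<And>w. w \<in> X \<Longrightarrow> (v, w) \<in> E \<Longrightarrow> w = u" "(v, v) \<notin> E"
    using symD[OF leaf.prems(1)] irreflD[OF leaf.prems(2)] leaf.hyps(4,5) by blast+
  have "u \<noteq> v" using leaf.hyps(2,3) by auto
  have new: "p \<in> X \<and> q \<in> X \<or> p = u \<and> q = v \<or> p = v \<and> q = u"
    if "(p, q) \<in> E" "p \<in> ?X" "q \<in> ?X" for p q
    using that E(2,3) leaf.hyps(5) by blast
  have "incident_arcs E S ?X =
      incident_arcs E S X \<union> ((if u \<in> S then {(u, v)} else {}) \<union> (if v \<in> S then {(v, u)} else {}))"
    using leaf.hyps(2-4) E(1) by (auto simp: incident_arcs_def dest: new)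
  moreover have "incident_arcs E S X \<inter> ((if u \<in> S then {(u, v)} else {}) \<union> (if v \<in> S then {(v, u)} else {})) = {}"
    using leaf.hyps(1-4) by (auto simp: incident_arcs_def)
  moreover have "card ((if u \<in> S then {(u, v)} else {}) \<union> (if v \<in> S then {(v, u)} else {})) = ?u + ?v"
    using \<open>u \<noteq> v\<close> by auto
  ultimately have D: "?D ?X = ?D X + ?u + ?v"
    using finite_incident_arcs[OF fin, of E S] by (simp add: card_Un_disjoint)
  have "inner_edges E S ?X = inner_edges E S X \<union> (if u \<in> S \<and> v \<in> S then {{u, v}} else {})"
    using leaf.hyps(2-4) E(1) by (auto simp: inner_edges_def insert_commute dest: new)
  moreover have "{u, v} \<notin> inner_edges E S X"
    using leaf.hyps(1-4) by (auto simp: inner_edges_def doubleton_eq_iff)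
  ultimately have I: "?I ?X = ?I X + ?u * ?v"
    using finite_inner_edges[OF fin, of E S] by auto
  have XS: "card (?X \<inter> S) = card (X \<inter> S) + ?v" and X: "card ?X = card X + 1"
    using leaf.hyps(1-4) fin by (auto simp: Int_insert_left)
  have nX: "?n ?X = ?n X * ((k - box_size S u) choose box_size S v)"
    using fin leaf.prems leaf.hyps(2-5) by (rule card_boxes_insert)
  \<comment> \<open>With 0/1 indicators the three exponents say: \<open>u\<close> is not in
    \<open>S\<close>, at least one end is in \<open>S\<close>, both ends are in
    \<open>S\<close>.\<close>
  have "2 ^ ?v * real (?n ?X) = real (?n X) *
      ((real k - 1) ^ (1 - ?u) * (real k - 2) ^ (?u + ?v - ?u * ?v) * (real k - 3) ^ (?u * ?v))"
  \<comment> \<open>For small \<open>k\<close> the natural subtraction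
    \<open>k - box_size S u\<close> may truncate. Without boxes on \<open>X\<close> both sides
    vanish; otherwise a set of that size inside \<open>{1..k}\<close> exists, and the subtraction is
    exact.\<close>
  proof (cases "boxes E X k (box_size S) = {}")
    case True
    then show ?thesis using nX by simp
  next
    case False
    then obtain A where "A u \<subseteq> {1..k}" "card (A u) = box_size S u"
      using \<open>u \<in> X\<close> by (auto simp: boxes_def PiE_iff)
    then have "box_size S u \<le> k" using card_mono[of "{1..k}" "A u"] by simp
    then show ?thesis unfolding nX
      by (auto simp: box_size_def real_choose_2 of_nat_diff)
  qed
  then have "2 ^ card (?X \<inter> S) * real (?n ?X) = 2 ^ card (X \<inter> S) * real (?n X) *
      ((real k - 1) ^ (1 - ?u) * (real k - 2) ^ (?u + ?v - ?u * ?v) * (real k - 3) ^ (?u * ?v))"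
    unfolding XS by (simp add: power_add mult.assoc)
  also have "\<dots> = real k * (real k - 1) ^ (a + (1 - ?u)) *
      (real k - 2) ^ (b + (?u + ?v - ?u * ?v)) * (real k - 3) ^ ?I ?X"
    unfolding n I by (simp add: power_add mult_ac)
  finally show ?case
    using ab D I XS X
    by (intro exI[of _ "a + (1 - ?u)"] exI[of _ "b + (?u + ?v - ?u * ?v)"]) auto
qed

section \<open>Induced hypercubes of the coloring graph are boxes\<close>

text \<open>On both sides adjacency becomes "differ in exactly one place", the form in which the
  rigidity of cubes is stated.\<close>

lemma induced_hypercube_iff_Pow:
  assumes "finite D" "U \<subseteq> proper_colorings G k"
  shows "digraph_iso (with_proj (coloring_graph G k) \<restriction> U) (with_proj (hypercube (card D))) \<longleftrightarrow>
    (\<exists>\<Phi>. bij_betw \<Phi> (Pow D) U \<and> (\<forall>I\<in>Pow D. \<forall>J\<in>Pow D.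
      (\<exists>!i. (i \<in> I) \<noteq> (i \<in> J)) \<longleftrightarrow> (\<exists>!v. \<Phi> I v \<noteq> \<Phi> J v)))"
    (is "?L \<longleftrightarrow> ?R")
proof -
  let ?Q = "hypercube (card D)"
  obtain g where g: "bij_betw g (pverts ?Q) (Pow D)"
    and garc: "\<forall>x\<in>pverts ?Q. \<forall>y\<in>pverts ?Q.
      (x, y) \<in> parcs ?Q \<longleftrightarrow> (\<exists>!i. (i \<in> g x) \<noteq> (i \<in> g y))"
    using hypercube_Pow[OF assms(1)] by (elim exE conjE)
  \<comment> \<open>Colorings agree outside the vertex set by extensionality, so the differing
    vertex need not be confined to it.\<close>
  have carc: "(f, f') \<in> parcs (coloring_graph G k) \<longleftrightarrow> (\<exists>!v. f v \<noteq> f' v)"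
    if "f \<in> U" "f' \<in> U" for f f'
  proof -
    have "f \<in> proper_colorings G k" "f' \<in> proper_colorings G k" using that assms(2) by auto
    moreover from this have "v \<in> pverts G \<and> f v \<noteq> f' v \<longleftrightarrow> f v \<noteq> f' v" for v
      by (cases "v \<in> pverts G") (auto simp: proper_colorings_def PiE_iff extensional_def)
    ultimately show ?thesis by (simp add: coloring_graph_def)
  qed
  have iso: "?L \<longleftrightarrow> (\<exists>h. bij_betw h U (pverts ?Q) \<and>
      (\<forall>x\<in>U. \<forall>y\<in>U. (x, y) \<in> parcs (coloring_graph G k) \<longleftrightarrow> (h x, h y) \<in> parcs ?Q))"
    by (rule digraph_iso_induce_iff[OF wf_coloring_graph wf_hypercube])
      (use assms(2) in \<open>simp add: coloring_graph_def\<close>)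
  show ?thesis
  proof
    assume ?L
    then obtain h where h: "bij_betw h U (pverts ?Q)"
      and harc: "\<forall>x\<in>U. \<forall>y\<in>U. (x, y) \<in> parcs (coloring_graph G k) \<longleftrightarrow> (h x, h y) \<in> parcs ?Q"
      unfolding iso by (elim exE conjE)
    have gh: "bij_betw (g \<circ> h) U (Pow D)" using h g by (rule bij_betw_trans)
    let ?\<Phi> = "inv_into U (g \<circ> h)"
    have bij: "bij_betw ?\<Phi> (Pow D) U" using gh by (rule bij_betw_inv_into)
    have arc: "(\<exists>!i. (i \<in> I) \<noteq> (i \<in> J)) \<longleftrightarrow> (\<exists>!v. ?\<Phi> I v \<noteq> ?\<Phi> J v)"
      if "I \<in> Pow D" "J \<in> Pow D" for I J
    proof -
      have U: "?\<Phi> I \<in> U" "?\<Phi> J \<in> U" using bij that by (auto simp: bij_betw_def)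
      have Q: "h (?\<Phi> I) \<in> pverts ?Q" "h (?\<Phi> J) \<in> pverts ?Q" using U h by (auto simp: bij_betw_def)
      have IJ: "g (h (?\<Phi> I)) = I" "g (h (?\<Phi> J)) = J"
        using bij_betw_inv_into_right[OF gh] that by auto
      have "(\<exists>!v. ?\<Phi> I v \<noteq> ?\<Phi> J v) \<longleftrightarrow> (h (?\<Phi> I), h (?\<Phi> J)) \<in> parcs ?Q"
        using carc[OF U] harc U by blast
      also have "\<dots> \<longleftrightarrow> (\<exists>!i. (i \<in> g (h (?\<Phi> I))) \<noteq> (i \<in> g (h (?\<Phi> J))))"
        using bspec[OF bspec[OF garc Q(1)] Q(2)] .
      finally show ?thesis unfolding IJ by (rule sym)
    qed
    show ?R by (intro exI[of _ ?\<Phi>] conjI ballI bij arc)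
  next
    assume ?R
    then obtain \<Phi> where \<Phi>: "bij_betw \<Phi> (Pow D) U"
      and \<Phi>arc: "\<forall>I\<in>Pow D. \<forall>J\<in>Pow D. (\<exists>!i. (i \<in> I) \<noteq> (i \<in> J)) \<longleftrightarrow> (\<exists>!v. \<Phi> I v \<noteq> \<Phi> J v)"
      by (elim exE conjE)
    have \<Phi>g: "bij_betw (\<Phi> \<circ> g) (pverts ?Q) U" using g \<Phi> by (rule bij_betw_trans)
    let ?h = "inv_into (pverts ?Q) (\<Phi> \<circ> g)"
    have bij: "bij_betw ?h U (pverts ?Q)" using \<Phi>g by (rule bij_betw_inv_into)
    have arc: "(x, y) \<in> parcs (coloring_graph G k) \<longleftrightarrow> (?h x, ?h y) \<in> parcs ?Q"
      if "x \<in> U" "y \<in> U" for x y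
    proof -
      have Q: "?h x \<in> pverts ?Q" "?h y \<in> pverts ?Q" using bij that by (auto simp: bij_betw_def)
      have P: "g (?h x) \<in> Pow D" "g (?h y) \<in> Pow D" using Q g by (auto simp: bij_betw_def)
      have xy: "\<Phi> (g (?h x)) = x" "\<Phi> (g (?h y)) = y"
        using bij_betw_inv_into_right[OF \<Phi>g] that by auto
      have "(?h x, ?h y) \<in> parcs ?Q \<longleftrightarrow> (\<exists>!i. (i \<in> g (?h x)) \<noteq> (i \<in> g (?h y)))"
        using bspec[OF bspec[OF garc Q(1)] Q(2)] .
      also have "\<dots> \<longleftrightarrow> (\<exists>!v. \<Phi> (g (?h x)) v \<noteq> \<Phi> (g (?h y)) v)"
        using bspec[OF bspec[OF \<Phi>arc P(1)] P(2)] .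
      also have "\<dots> \<longleftrightarrow> (x, y) \<in> parcs (coloring_graph G k)"
        unfolding xy using carc[OF that] by (rule sym)
      finally show ?thesis by (rule sym)
    qed
    show ?L unfolding iso by (intro exI[of _ ?h] conjI ballI bij arc)
  qed
qed

lemma box_subset_proper_colorings:
  assumes "pair_wf_digraph T" "A \<in> boxes (parcs T) (pverts T) k s"
  shows "PiE (pverts T) A \<subseteq> proper_colorings T k"
proof
  fix f assume f: "f \<in> PiE (pverts T) A"
  have "f u \<noteq> f v" if "(u, v) \<in> parcs T" for u v
  proof -
    have "u \<in> pverts T" "v \<in> pverts T"
      using assms(1) that by (auto dest: pair_wf_digraph.wellformed')
    then have "f u \<in> A u" "f v \<in> A v" "A u \<inter> A v = {}"
      using f assms(2) that unfolding boxes_def by blast+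
    then show ?thesis by auto
  qed
  moreover have "f \<in> pverts T \<rightarrow>\<^sub>E {1..k}"
    using f assms(2) unfolding boxes_def PiE_iff by blast
  ultimately show "f \<in> proper_colorings T k" by (simp add: proper_colorings_def)
qed

text \<open>Name the two colors at each vertex of \<open>S\<close> low and high. Raising exactly the
  vertices of \<open>J\<close> parametrizes the box by subsets, and two points differ exactly on the
  symmetric difference.\<close>

lemma box_induces_hypercube:
  assumes "pair_fin_digraph T" "S \<subseteq> pverts T"
    and A: "A \<in> boxes (parcs T) (pverts T) k (box_size S)"
  shows "digraph_iso (with_proj (coloring_graph T k) \<restriction> PiE (pverts T) A)
    (with_proj (hypercube (card S)))"
proof -
  interpret pair_fin_digraph T by fact
  let ?V = "pverts T"
  have finS: "finite S" using assms(2) pair_finite_verts by (rule finite_subset)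
  have "\<exists>l h. A v = (if v \<in> S then {l, h} else {l}) \<and> (v \<in> S \<longrightarrow> l \<noteq> h)" if "v \<in> ?V" for v
  proof (cases "v \<in> S")
    case True
    then have "card (A v) = 2" using A that by (simp add: boxes_def box_size_def)
    then show ?thesis using True by (auto simp: card_2_iff)
  next
    case False
    then have "card (A v) = 1" using A that by (simp add: boxes_def box_size_def)
    then show ?thesis using False by (auto simp: card_1_singleton_iff)
  qed
  then obtain l h where lh: "\<And>v. v \<in> ?V \<Longrightarrow> A v = (if v \<in> S then {l v, h v} else {l v})"
    "\<And>v. v \<in> ?V \<Longrightarrow> v \<in> S \<Longrightarrow> l v \<noteq> h v"
    by metis
  define \<Phi> where "\<Phi> J = (\<lambda>v\<in>?V. if v \<in> J then h v else l v)" for J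
  have diff: "\<Phi> I v \<noteq> \<Phi> J v \<longleftrightarrow> (v \<in> I) \<noteq> (v \<in> J)" if "I \<subseteq> S" "J \<subseteq> S" for I J v
    using that lh(2)[of v] assms(2) by (auto simp: \<Phi>_def)
  have bij: "bij_betw \<Phi> (Pow S) (PiE ?V A)"
  proof (rule bij_betwI')
    fix I J assume "I \<in> Pow S" "J \<in> Pow S"
    then show "(\<Phi> I = \<Phi> J) = (I = J)" using diff[of I J] by (auto simp: fun_eq_iff)
  next
    fix J assume "J \<in> Pow S"
    then show "\<Phi> J \<in> PiE ?V A" using lh(1) by (auto simp: \<Phi>_def)
  next
    fix f assume f: "f \<in> PiE ?V A"
    have "f v = \<Phi> {v \<in> S. f v = h v} v" for v
    proof (cases "v \<in> ?V")
      case True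
      then have "f v \<in> A v" using f by auto
      then show ?thesis using True lh(1)[OF True] by (auto simp: \<Phi>_def split: if_splits)
    next
      case False
      then show ?thesis using f by (auto simp: \<Phi>_def)
    qed
    then have "f = \<Phi> {v \<in> S. f v = h v}" by (rule ext)
    moreover have "{v \<in> S. f v = h v} \<in> Pow S" by auto
    ultimately show "\<exists>J\<in>Pow S. f = \<Phi> J" by (rule bexI)
  qed
  have arc: "(\<exists>!i. (i \<in> I) \<noteq> (i \<in> J)) \<longleftrightarrow> (\<exists>!v. \<Phi> I v \<noteq> \<Phi> J v)"
    if "I \<in> Pow S" "J \<in> Pow S" for I J
    using diff[of I J] that by simp
  show ?thesis
    unfolding induced_hypercube_iff_Pow[OF finS box_subset_proper_colorings[OF pair_wf_digraph_axioms A]]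
    by (intro exI[of _ \<Phi>] conjI ballI bij arc)
qed

text \<open>Rigidity gives the moving vertices and their second colors. Once \<open>U\<close> is
  known to be a full product, the base coloring may be changed freely within the sets
  \<open>A v\<close>, and properness of the results gives the conditions on
  \<open>A\<close>.\<close>

lemma induced_hypercube_is_box:
  assumes U: "U \<subseteq> proper_colorings T k"
    and iso: "digraph_iso (with_proj (coloring_graph T k) \<restriction> U) (with_proj (hypercube d))"
  obtains S A where "S \<subseteq> pverts T" "card S = d"
    "A \<in> boxes (parcs T) (pverts T) k (box_size S)" "U = PiE (pverts T) A"
proof -
  let ?V = "pverts T" and ?D = "{..<d}"
  have "digraph_iso (with_proj (coloring_graph T k) \<restriction> U) (with_proj (hypercube (card ?D)))"
    using iso by simp
  then obtain \<Phi> where \<Phi>: "bij_betw \<Phi> (Pow ?D) U"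
    and arc: "\<forall>I\<in>Pow ?D. \<forall>J\<in>Pow ?D. (\<exists>!i. (i \<in> I) \<noteq> (i \<in> J)) \<longleftrightarrow> (\<exists>!v. \<Phi> I v \<noteq> \<Phi> J v)"
    unfolding induced_hypercube_iff_Pow[OF finite_lessThan U] by (elim exE conjE)
  have inj: "inj_on \<Phi> (Pow ?D)" and img: "\<Phi> ` Pow ?D = U" using \<Phi> by (auto simp: bij_betw_def)
  have arc': "(\<exists>!i. (i \<in> I) \<noteq> (i \<in> J)) \<longleftrightarrow> (\<exists>!v. \<Phi> I v \<noteq> \<Phi> J v)"
    if "I \<subseteq> ?D" "J \<subseteq> ?D" for I J
    by (rule bspec[OF bspec[OF arc]]) (use that in simp_all)
  obtain x c where x: "inj_on x ?D" and c: "\<And>v. v \<in> x ` ?D \<Longrightarrow> c v \<noteq> \<Phi> {} v"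
    and \<Phi>eq: "\<And>J. J \<subseteq> ?D \<Longrightarrow> \<Phi> J = (\<lambda>v. if v \<in> x ` J then c v else \<Phi> {} v)"
    by (rule cube_rigid[OF finite_lessThan inj arc'], assumption, assumption, rule that)
  have ext: "f v = undefined" if "f \<in> U" "v \<notin> ?V" for f v
    using U that by (auto simp: proper_colorings_def PiE_iff extensional_def)
  define S where "S = x ` ?D"
  define A where "A = (\<lambda>v\<in>?V. if v \<in> S then {\<Phi> {} v, c v} else {\<Phi> {} v})"
  have U0: "\<Phi> J \<in> U" if "J \<subseteq> ?D" for J using img that by blast
  have SV: "S \<subseteq> ?V"
  proof
    fix v assume v: "v \<in> S"
    show "v \<in> ?V"
    proof (rule ccontr)
      assume "v \<notin> ?V"
      \<comment> \<open>Outside the vertex set all colorings are \<open>undefined\<close>, so no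
        coordinate there can move.\<close>
      then have "\<Phi> ?D v = \<Phi> {} v" using ext[OF U0] by simp
      then show False using c[of v] v \<Phi>eq[of ?D] by (simp add: S_def)
    qed
  qed
  have UA: "U = PiE ?V A"
  proof (intro equalityI subsetI)
    fix f assume "f \<in> U"
    then obtain J where J: "J \<subseteq> ?D" "f = \<Phi> J" using img by blast
    have "x ` J \<subseteq> S" using J by (auto simp: S_def)
    then have "\<Phi> J v \<in> A v" if "v \<in> ?V" for v
      using that \<Phi>eq[OF J(1)] by (auto simp: A_def)
    then show "f \<in> PiE ?V A" using ext[OF \<open>f \<in> U\<close>] J by (auto simp: PiE_iff extensional_def)
  next
    fix f assume f: "f \<in> PiE ?V A"
    define J where "J = {i \<in> ?D. f (x i) = c (x i)}"
    have J: "J \<subseteq> ?D" by (auto simp: J_def)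
    have "f v = \<Phi> J v" for v
    proof (cases "v \<in> ?V")
      case True
      then have "f v \<in> A v" using f by auto
      moreover have "v \<in> x ` J \<longleftrightarrow> v \<in> S \<and> f v = c v" by (auto simp: J_def S_def)
      ultimately show ?thesis using True \<Phi>eq[OF J] by (auto simp: A_def split: if_splits)
    next
      case False
      then show ?thesis using f ext[OF U0[OF J]] by auto
    qed
    then have "f = \<Phi> J" by auto
    then show "f \<in> U" using U0[OF J] by simp
  qed
  have f0: "\<Phi> {} \<in> PiE ?V A" using U0 UA by simp
  have "A \<in> boxes (parcs T) ?V k (box_size S)"
    unfolding boxes_def
  proof (intro CollectI conjI ballI impI)
    show "A \<in> ?V \<rightarrow>\<^sub>E Pow {1..k}"
    proof (rule PiE_I)
      fix v assume v: "v \<in> ?V"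
      show "A v \<in> Pow {1..k}"
      proof
        show "A v \<subseteq> {1..k}"
        proof
          fix a assume "a \<in> A v"
          then have "(\<Phi> {})(v := a) \<in> U" unfolding UA using f0 v by (auto simp: PiE_iff extensional_def)
          then have "((\<Phi> {})(v := a)) v \<in> {1..k}"
            using U v unfolding proper_colorings_def PiE_iff by blast
          then show "a \<in> {1..k}" by simp
        qed
      qed
    qed (simp add: A_def)
  next
    fix v assume "v \<in> ?V"
    then show "card (A v) = box_size S v"
      using c[of v] by (auto simp: A_def box_size_def S_def)
  next
    fix u v assume uv: "u \<in> ?V" "v \<in> ?V" "(u, v) \<in> parcs T"
    show "A u \<inter> A v = {}"
    proof (rule ccontr)
      assume "A u \<inter> A v \<noteq> {}"
      then obtain a where "a \<in> A u" "a \<in> A v" by blast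
      \<comment> \<open>A shared color could be given to both ends of the arc at once, which is an
        improper member of \<open>U\<close>.\<close>
      then have "(\<Phi> {})(u := a, v := a) \<in> U"
        unfolding UA using f0 uv by (auto simp: PiE_iff extensional_def)
      then have "((\<Phi> {})(u := a, v := a)) u \<noteq> ((\<Phi> {})(u := a, v := a)) v"
        using U uv(3) unfolding proper_colorings_def by blast
      then show False by (simp add: fun_upd_def split: if_splits)
    qed
  qed
  then show ?thesis using that[of S A] SV UA x by (simp add: S_def card_image)
qed

text \<open>All factors are nonempty, so the product determines them, and \<open>S\<close> is where
  they have two elements. Hence no cube is counted twice, within one \<open>S\<close> or across
  different ones.\<close>

lemma box_unique:
  assumes "A \<in> boxes E V k (box_size S)" "B \<in> boxes E V k (box_size S')"
    and "S \<subseteq> V" "S' \<subseteq> V" "PiE V A = PiE V B"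
  shows "A = B \<and> S = S'"
proof -
  have size: "card (A v) = box_size S v" "card (B v) = box_size S' v" if "v \<in> V" for v
    using assms(1,2) that by (auto simp: boxes_def)
  then have "A v \<noteq> {}" "B v \<noteq> {}" if "v \<in> V" for v
    using that by (force simp: box_size_def split: if_splits)+
  then have eq: "A v = B v" if "v \<in> V" for v
    using PiE_eq_iff_not_empty[of V A B] assms(5) that by blast
  have "A \<in> extensional V" "B \<in> extensional V"
    using assms(1,2) by (auto simp: boxes_def PiE_iff)
  then have "A = B" using eq by (rule extensionalityI)
  have "v \<in> S \<longleftrightarrow> v \<in> S'" if "v \<in> V" for v
  proof -
    have "box_size S v = box_size S' v" using size[OF that] eq[OF that] by simp
    then show ?thesis by (simp add: box_size_def split: if_splits)
  qed
  then have "S = S'" using assms(3,4) by (intro set_eqI) blast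
  then show ?thesis using \<open>A = B\<close> by simp
qed

section \<open>Summing over the sets of switching vertices\<close>

lemma induced_count_hypercube:
  assumes "pair_fin_digraph T"
  shows "induced_count T (hypercube d) k =
    (\<Sum>S | S \<subseteq> pverts T \<and> card S = d. card (boxes (parcs T) (pverts T) k (box_size S)))"
proof -
  interpret pair_fin_digraph T by fact
  let ?V = "pverts T" and ?B = "\<lambda>S. boxes (parcs T) (pverts T) k (box_size S)"
  let ?\<S> = "{S. S \<subseteq> ?V \<and> card S = d}"
  have pv: "pverts (coloring_graph T k) = proper_colorings T k" by (simp add: coloring_graph_def)
  have "{U. U \<subseteq> pverts (coloring_graph T k) \<and>
      digraph_iso (with_proj (coloring_graph T k) \<restriction> U) (with_proj (hypercube d))} =
    (\<Union>S\<in>?\<S>. PiE ?V ` ?B S)" (is "?L = ?R")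
  proof (intro equalityI subsetI)
    fix U assume "U \<in> ?L"
    then have "U \<subseteq> proper_colorings T k"
      and "digraph_iso (with_proj (coloring_graph T k) \<restriction> U) (with_proj (hypercube d))"
      by (auto simp: pv)
    then show "U \<in> ?R" by (rule induced_hypercube_is_box) blast
  next
    fix U assume "U \<in> ?R"
    then obtain S A where S: "S \<subseteq> ?V" "card S = d" and A: "A \<in> ?B S" and U: "U = PiE ?V A"
      by blast
    show "U \<in> ?L"
      using box_induces_hypercube[OF assms S(1) A] S(2)
        box_subset_proper_colorings[OF pair_wf_digraph_axioms A] U by (simp add: pv)
  qed
  moreover have "card ?R = (\<Sum>S\<in>?\<S>. card (PiE ?V ` ?B S))"
  proof (rule card_UN_disjoint)
    show "finite ?\<S>" using pair_finite_verts by simp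
    show "\<forall>S\<in>?\<S>. finite (PiE ?V ` ?B S)" using pair_finite_verts by (simp add: finite_boxes)
    show "\<forall>S\<in>?\<S>. \<forall>S'\<in>?\<S>. S \<noteq> S' \<longrightarrow> PiE ?V ` ?B S \<inter> PiE ?V ` ?B S' = {}"
      using box_unique by blast
  qed
  moreover have "card (PiE ?V ` ?B S) = card (?B S)" if "S \<in> ?\<S>" for S
    by (rule card_image, rule inj_onI) (use box_unique that in blast)
  ultimately show ?thesis unfolding induced_count_def by simp
qed

theorem theorem4p3:
  fixes T :: "'a pair_pre_digraph" and n d k :: nat
  assumes "is_tree T"
    and "card (pverts T) = n"
    and "d \<ge> 1"
    and "k \<ge> 1"
  shows "real (induced_count T (hypercube d) k) =
    1 / 2 ^ d *
      (\<Sum>S | S \<subseteq> pverts T \<and> card S = d.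
         real k
         * (real k - 1) powi (int n + int d - 1 - int (deg_set T S))
         * (real k - 2) powi (int (deg_set T S) - int (int_set T S))
         * (real k - 3) ^ int_set T S)"
proof -
  interpret pair_graph T using assms(1) by (simp add: is_tree_def)
  let ?B = "\<lambda>S. boxes (parcs T) (pverts T) k (box_size S)"
  have sym_parcs: "sym (parcs T)" by (rule symI) (rule arcs_symmetric)
  have irr: "irrefl (parcs T)" using no_loops' by (auto simp: irrefl_def)
  have "real (card (?B S)) = 1 / 2 ^ d * (real k
         * (real k - 1) powi (int n + int d - 1 - int (deg_set T S))
         * (real k - 2) powi (int (deg_set T S) - int (int_set T S))
         * (real k - 3) ^ int_set T S)" if S: "S \<subseteq> pverts T" "card S = d" for S
  proof -
    have finS: "finite S" using S(1) pair_finite_verts by (rule finite_subset)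
    have "finite (out_arcs (with_proj T) v)" for v
      by (rule finite_subset[OF _ pair_finite_arcs]) (auto simp: out_arcs_def)
    \<comment> \<open>The degree sum counts pairs of a vertex and an arc leaving it. The arc
      determines its tail, so these are just the arcs that start in \<open>S\<close>.\<close>
    then have "deg_set T S = card (SIGMA v:S. out_arcs (with_proj T) v)"
      using finS by (simp add: deg_set_def out_degree_def)
    also have "\<dots> = card (snd ` (SIGMA v:S. out_arcs (with_proj T) v))"
      by (rule card_image[symmetric]) (auto simp: inj_on_def out_arcs_def)
    also have "snd ` (SIGMA v:S. out_arcs (with_proj T) v) = incident_arcs (parcs T) S (pverts T)"
      using S(1) by (force simp: incident_arcs_def out_arcs_def image_iff dest: in_arcsD1 in_arcsD2)
    finally have deg: "card (incident_arcs (parcs T) S (pverts T)) = deg_set T S" by (rule sym)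
    have "S \<inter> pverts T = S" using S(1) by blast
    then have int: "card (inner_edges (parcs T) S (pverts T)) = int_set T S"
      by (simp add: inner_edges_def int_set_def)
    have VS: "card (pverts T \<inter> S) = d" using S by (simp add: Int_absorb1)
    obtain a b where "a + deg_set T S + 1 = n + d" "b + int_set T S = deg_set T S"
      and count: "2 ^ d * real (card (?B S)) =
        real k * (real k - 1) ^ a * (real k - 2) ^ b * (real k - 3) ^ int_set T S"
      using card_boxes_grown[OF is_tree_grown[OF assms(1)] sym_parcs irr, of S k]
      unfolding deg int VS assms(2) by blast
    \<comment> \<open>Both integer exponents are natural numbers, so \<open>powi\<close> is an
      ordinary power, also where the base is 0.\<close>
    then have "int n + int d - 1 - int (deg_set T S) = int a"
      "int (deg_set T S) - int (int_set T S) = int b" by linarith+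
    then show ?thesis using count by (simp add: field_simps)
  qed
  then show ?thesis
    unfolding induced_count_hypercube[OF pair_fin_digraph] sum_distrib_left of_nat_sum
    by (intro sum.cong) auto
qed

end
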